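(* Let $\mathcal F=\{x_j\}_{j\in J}$ be a frame of vectors of norm $1$ in a separable real Hilbert space $\mathcal H$, with analysis operator $T^*$, and let $P:\mathcal H\to\mathcal H$ be an orthogonal projection. (a) $\mathcal F$ is scalable if and only if there exists $\vec c\in\ell^\infty(J)$ such that for every $u,f\in\mathcal H$, $$-\tfrac12\|f\|^2\le \tfrac12\|D_{\vec c}T^*u\|^2-\langle f,u\rangle\le \tfrac12\|u\|^2-\langle f,u\rangle .$$ (b) $\mathcal F$ is piecewise scalable with projection $P$ if and only if there exist $\vec a,\vec b\in\ell^\infty(J)$ such that $$\langle D_{\vec a}T^*Pu,\ D_{\vec b}T^*(I-P)w\rangle=0\quad\text{for every }u,w\in\mathcal H,$$ and, for every $u,f\in\mathcal H$, $$-\tfrac12\|f\|^2\le \tfrac12\big(\|D_{\vec a}T^*Pu\|^2+\|D_{\vec b}T^*(I-P)u\|^2\big)-\langle f,u\rangle\le \tfrac12\|u\|^2-\langle f,u\rangle .$$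
   Context: $J\subset\mathbb N$ is a nonempty (finite or infinite) index set; $\ell^2(J)$ and $\ell^\infty(J)$ are the spaces of square-summable, respectively bounded, real sequences indexed by $J$. A sequence of distinct vectors $\{x_j\}_{j\in J}$ in $\mathcal H$ is a frame if there are constants $A,B>0$ with $A\|x\|^2\le\sum_{j\in J}|\langle x,x_j\rangle|^2\le B\|x\|^2$ for all $x\in\mathcal H$. A family $\{y_j\}_{j\in J}$ in $\mathcal H$ (zero vectors and repetitions allowed) is a Parseval frame if $\sum_{j\in J}|\langle x,y_j\rangle|^2=\|x\|^2$ for all $x\in\mathcal H$. The analysis operator is $T^*:\mathcal H\to\ell^2(J)$, $T^*x=(\langle x,x_j\rangle)_{j\in J}$. For $\vec c\in\ell^\infty(J)$, $D_{\vec c}:\ell^2(J)\to\ell^2(J)$ is $D_{\vec c}(\vec y)=(c_jy_j)_{j\in J}$. $\mathcal F$ is scalable if there is $\vec c\in\ell^\infty(J)$ such that $\{c_jx_j\}_{j\in J}$ is a Parseval frame. $\mathcal F$ is piecewise scalable with projection $P$ if there are $\vec a,\vec b\in\ell^\infty(J)$ such that $\{a_jPx_j+b_j(I-P)x_j\}_{j\in J}$ is a Parseval frame for $\mathcal H$. *)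

theory Defs
  imports "HOL-Analysis.Analysis"
begin

text \<open>
  A real sequence indexed by \<open>J\<close> is represented by a function on all of \<open>nat\<close> that
  vanishes outside \<open>J\<close>, so that equality in \<open>l2 J\<close> and \<open>l_infty J\<close> is equality of functions.
\<close>

definition l2 :: "nat set \<Rightarrow> (nat \<Rightarrow> real) set" where
  "l2 J = {y. (\<forall>j. j \<notin> J \<longrightarrow> y j = 0) \<and> (\<lambda>j. (y j)\<^sup>2) summable_on J}"

definition l2_inner :: "nat set \<Rightarrow> (nat \<Rightarrow> real) \<Rightarrow> (nat \<Rightarrow> real) \<Rightarrow> real" where
  "l2_inner J y z = (\<Sum>\<^sub>\<infinity>j\<in>J. y j * z j)"

definition l2_norm :: "nat set \<Rightarrow> (nat \<Rightarrow> real) \<Rightarrow> real" where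
  "l2_norm J y = sqrt (l2_inner J y y)"

definition l_infty :: "nat set \<Rightarrow> (nat \<Rightarrow> real) set" where
  "l_infty J = {c. (\<forall>j. j \<notin> J \<longrightarrow> c j = 0) \<and> bounded (c ` J)}"

definition frame :: "nat set \<Rightarrow> (nat \<Rightarrow> 'a::real_inner) \<Rightarrow> bool" where
  "frame J x \<longleftrightarrow> inj_on x J \<and>
     (\<exists>A B. 0 < A \<and> 0 < B \<and>
       (\<forall>u. (\<lambda>j. (u \<bullet> x j)\<^sup>2) summable_on J \<and>
            A * (norm u)\<^sup>2 \<le> (\<Sum>\<^sub>\<infinity>j\<in>J. (u \<bullet> x j)\<^sup>2) \<and>
            (\<Sum>\<^sub>\<infinity>j\<in>J. (u \<bullet> x j)\<^sup>2) \<le> B * (norm u)\<^sup>2))"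

text \<open>Unlike in \<open>frame\<close>, repetitions (and zero vectors) are allowed here.\<close>

definition parseval_frame :: "nat set \<Rightarrow> (nat \<Rightarrow> 'a::real_inner) \<Rightarrow> bool" where
  "parseval_frame J y \<longleftrightarrow> (\<forall>u. ((\<lambda>j. (u \<bullet> y j)\<^sup>2) has_sum (norm u)\<^sup>2) J)"

definition analysis_op :: "nat set \<Rightarrow> (nat \<Rightarrow> 'a::real_inner) \<Rightarrow> 'a \<Rightarrow> nat \<Rightarrow> real" where
  "analysis_op J x u = (\<lambda>j. if j \<in> J then u \<bullet> x j else 0)"

definition diag_op :: "(nat \<Rightarrow> real) \<Rightarrow> (nat \<Rightarrow> real) \<Rightarrow> nat \<Rightarrow> real" where
  "diag_op c y = (\<lambda>j. c j * y j)"

definition orthogonal_projection :: "('a::real_inner \<Rightarrow> 'a) \<Rightarrow> bool" where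
  "orthogonal_projection P \<longleftrightarrow>
     bounded_linear P \<and> (\<forall>u. P (P u) = P u) \<and> (\<forall>u v. P u \<bullet> v = u \<bullet> P v)"

definition scalable :: "nat set \<Rightarrow> (nat \<Rightarrow> 'a::real_inner) \<Rightarrow> bool" where
  "scalable J x \<longleftrightarrow> (\<exists>c\<in>l_infty J. parseval_frame J (\<lambda>j. c j *\<^sub>R x j))"

definition piecewise_scalable ::
    "nat set \<Rightarrow> (nat \<Rightarrow> 'a::real_inner) \<Rightarrow> ('a \<Rightarrow> 'a) \<Rightarrow> bool" where
  "piecewise_scalable J x P \<longleftrightarrow>
     (\<exists>a\<in>l_infty J. \<exists>b\<in>l_infty J.
        parseval_frame J (\<lambda>j. a j *\<^sub>R P (x j) + b j *\<^sub>R (x j - P (x j))))"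

text \<open>
  The infinite sums in \<open>l2_inner\<close> and \<open>l2_norm\<close> default to \<open>0\<close> when they diverge.
  The next lemmas show that they converge wherever these notions are applied to a frame.
\<close>

lemma analysis_op_in_l2: "frame J x \<Longrightarrow> analysis_op J x u \<in> l2 J"
  unfolding frame_def l2_def analysis_op_def
  by (auto cong: summable_on_cong)

lemma diag_op_in_l2:
  assumes "c \<in> l_infty J" "y \<in> l2 J"
  shows "diag_op c y \<in> l2 J"
proof -
  obtain K where K: "\<And>j. j \<in> J \<Longrightarrow> \<bar>c j\<bar> \<le> K"
    using assms(1) by (auto simp: l_infty_def bounded_iff)
  have "(\<lambda>j. (c j * y j)\<^sup>2) summable_on J"
  proof (rule summable_on_comparison_test)
    show "(\<lambda>j. K\<^sup>2 * (y j)\<^sup>2) summable_on J"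
      using assms(2) by (auto simp: l2_def intro: summable_on_cmult_right)
    show "(c j * y j)\<^sup>2 \<le> K\<^sup>2 * (y j)\<^sup>2" if "j \<in> J" for j
    proof -
      have "(c j)\<^sup>2 \<le> K\<^sup>2"
        using power_mono[OF K[OF that], of 2] by simp
      thus ?thesis
        by (simp add: power_mult_distrib mult_right_mono)
    qed
  qed simp
  with assms(2) show ?thesis
    by (auto simp: l2_def diag_op_def)
qed

lemma l2_inner_summable:
  assumes "y \<in> l2 J" "z \<in> l2 J"
  shows "(\<lambda>j. y j * z j) summable_on J"
proof -
  have "(\<lambda>j. norm (y j * z j)) summable_on J"
  proof (rule Infinite_Sum.abs_summable_on_comparison_test')
    show "(\<lambda>j. (y j)\<^sup>2 + (z j)\<^sup>2) summable_on J"
      using assms by (auto simp: l2_def intro: summable_on_add)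
    show "norm (y j * z j) \<le> (y j)\<^sup>2 + (z j)\<^sup>2" for j
    proof -
      have "2 * \<bar>y j\<bar> * \<bar>z j\<bar> \<le> (y j)\<^sup>2 + (z j)\<^sup>2"
        using sum_squares_bound[of "\<bar>y j\<bar>" "\<bar>z j\<bar>"] by simp
      moreover have "0 \<le> \<bar>y j\<bar> * \<bar>z j\<bar>" by simp
      ultimately show ?thesis
        by (simp only: real_norm_def abs_mult)
    qed
  qed
  thus ?thesis
    by (rule abs_summable_summable)
qed

end

theory Submission
  imports Defs
begin

text \<open>
  Fix \<open>u\<close> and let \<open>q\<close> be the energy \<open>\<parallel>D\<^sub>cT\<^sup>*u\<parallel>\<^sup>2\<close>. By Young's inequality, \<open>f \<bullet> u - \<parallel>f\<parallel>\<^sup>2/2\<close> is at most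
  \<open>\<parallel>u\<parallel>\<^sup>2/2\<close>, with equality at \<open>f = u\<close>. Hence the lower bound, required for every \<open>f\<close>, says exactly
  \<open>\<parallel>u\<parallel>\<^sup>2 \<le> q\<close>, while \<open>f\<close> cancels from the upper bound, which says \<open>q \<le> \<parallel>u\<parallel>\<^sup>2\<close>. So the
  variational condition is the Parseval identity \<open>q = \<parallel>u\<parallel>\<^sup>2\<close> in disguise
  (\<open>variational_bounds_iff\<close>), and this is scalability, because \<open>D\<^sub>cT\<^sup>*\<close> is the analysis operator
  of the scaled family.

  In the piecewise case the analysis operator of the new family is \<open>D\<^sub>aT\<^sup>*P + D\<^sub>bT\<^sup>*(I - P)\<close>, as \<open>P\<close>
  is self-adjoint. If the cross terms vanish, the energy splits into the sum of the two partial
  energies, and the previous argument applies. Conversely, a Parseval frame makes this operator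
  isometric. It takes \<open>Pu + (I - P)w\<close> and \<open>Pu - (I - P)w\<close>, which have equal norms, to the sum and
  the difference of \<open>D\<^sub>aT\<^sup>*Pu\<close> and \<open>D\<^sub>bT\<^sup>*(I - P)w\<close>; these then have equal norms as well, so the
  two sequences are orthogonal (\<open>parseval_splitting_iff\<close>).
\<close>

lemma variational_bounds_iff:
  fixes u :: "'a::real_inner"
  shows "(\<forall>f. - (1/2) * (norm f)\<^sup>2 \<le> (1/2) * q - f \<bullet> u \<and>
              (1/2) * q - f \<bullet> u \<le> (1/2) * (norm u)\<^sup>2 - f \<bullet> u) \<longleftrightarrow> q = (norm u)\<^sup>2"
    (is "?bounds \<longleftrightarrow> _")
proof
  assume ?bounds
  \<comment> \<open>The choice \<open>f = u\<close> is the maximiser of \<open>f \<bullet> u - \<parallel>f\<parallel>\<^sup>2/2\<close>.\<close>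
  from this[rule_format, of u] show "q = (norm u)\<^sup>2"
    by (simp add: power2_norm_eq_inner)
next
  assume q: "q = (norm u)\<^sup>2"
  have "2 * (f \<bullet> u) \<le> (norm f)\<^sup>2 + (norm u)\<^sup>2" for f
    using inner_ge_zero[of "f - u"]
    by (simp add: power2_norm_eq_inner inner_diff inner_commute)
  then show ?bounds
    using q by (auto simp: field_simps)
qed

lemma l2_norm_power2: "(l2_norm J y)\<^sup>2 = l2_inner J y y"
  unfolding l2_norm_def l2_inner_def by (simp add: infsum_nonneg)

lemma l2_add:
  assumes "y \<in> l2 J" "z \<in> l2 J"
  shows "(\<lambda>j. y j + z j) \<in> l2 J"
proof -
  have "(\<lambda>j. y j * y j + z j * z j + 2 * (y j * z j)) summable_on J"
    using assms by (intro summable_on_add summable_on_cmult_right l2_inner_summable)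
  then show ?thesis
    using assms by (simp add: l2_def power2_eq_square algebra_simps)
qed

lemma l2_norm_add_power2:
  assumes "y \<in> l2 J" "z \<in> l2 J"
  shows "(l2_norm J (\<lambda>j. y j + z j))\<^sup>2
           = (l2_norm J y)\<^sup>2 + (l2_norm J z)\<^sup>2 + 2 * l2_inner J y z"
proof -
  note summable = l2_inner_summable[OF assms(1) assms(1)] l2_inner_summable[OF assms(2) assms(2)]
    l2_inner_summable[OF assms]
  have "(l2_norm J (\<lambda>j. y j + z j))\<^sup>2
      = (\<Sum>\<^sub>\<infinity>j\<in>J. y j * y j + z j * z j + 2 * (y j * z j))"
    unfolding l2_norm_power2 l2_inner_def by (simp add: algebra_simps)
  also have "\<dots> = (\<Sum>\<^sub>\<infinity>j\<in>J. y j * y j) + (\<Sum>\<^sub>\<infinity>j\<in>J. z j * z j) + 2 * (\<Sum>\<^sub>\<infinity>j\<in>J. y j * z j)"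
    using summable by (simp add: infsum_add infsum_cmult_right summable_on_add summable_on_cmult_right)
  finally show ?thesis
    by (simp add: l2_norm_power2 l2_inner_def)
qed

lemma parseval_frame_iff_isometry:
  assumes "\<And>u. analysis_op J y u \<in> l2 J"
  shows "parseval_frame J y \<longleftrightarrow> (\<forall>u. (l2_norm J (analysis_op J y u))\<^sup>2 = (norm u)\<^sup>2)"
proof -
  have "(l2_norm J (analysis_op J y u))\<^sup>2 = (\<Sum>\<^sub>\<infinity>j\<in>J. (u \<bullet> y j)\<^sup>2)" for u
    unfolding l2_norm_power2 l2_inner_def
    by (intro infsum_cong) (simp add: analysis_op_def power2_eq_square)
  moreover have "(\<lambda>j. (u \<bullet> y j)\<^sup>2) summable_on J" for u
    using assms[of u] by (auto simp: l2_def analysis_op_def cong: summable_on_cong)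
  ultimately show ?thesis
    by (simp add: parseval_frame_def has_sum_iff)
qed

lemma analysis_op_scaleR:
  "analysis_op J (\<lambda>j. c j *\<^sub>R x j) u = diag_op c (analysis_op J x u)"
  by (auto simp: analysis_op_def diag_op_def)

lemma analysis_op_piecewise:
  assumes "orthogonal_projection P"
  shows "analysis_op J (\<lambda>j. a j *\<^sub>R P (x j) + b j *\<^sub>R (x j - P (x j))) u
           = (\<lambda>j. diag_op a (analysis_op J x (P u)) j + diag_op b (analysis_op J x (u - P u)) j)"
proof -
  have "u \<bullet> P v = P u \<bullet> v" for v
    using assms by (simp add: orthogonal_projection_def)
  then show ?thesis
    by (auto simp: analysis_op_def diag_op_def inner_add inner_diff)
qed

lemma norm_power2_projection_split:
  assumes "orthogonal_projection P"
  shows "(norm (P u + (w - P w)))\<^sup>2 = (norm (P u))\<^sup>2 + (norm (w - P w))\<^sup>2"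
proof -
  have "P u \<bullet> P w = P u \<bullet> w"
    using assms unfolding orthogonal_projection_def by metis
  then have "P u \<bullet> (w - P w) = 0"
    by (simp add: inner_diff)
  then show ?thesis
    by (simp add: power2_norm_eq_inner inner_add inner_commute)
qed

text \<open>
  Replacing \<open>w\<close> by \<open>-w\<close> keeps the norm of \<open>Pu + (I - P)w\<close> and reverses the sign of the cross term
  in the energy of its image; an isometry therefore has no cross terms.
\<close>

lemma parseval_splitting_iff:
  fixes x :: "nat \<Rightarrow> 'a::real_inner"
  assumes frame: "frame J x" and P: "orthogonal_projection P"
    and a: "a \<in> l_infty J" and b: "b \<in> l_infty J"
  defines "A \<equiv> \<lambda>u. diag_op a (analysis_op J x (P u))"
    and "B \<equiv> \<lambda>u. diag_op b (analysis_op J x (u - P u))"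
  shows "parseval_frame J (\<lambda>j. a j *\<^sub>R P (x j) + b j *\<^sub>R (x j - P (x j))) \<longleftrightarrow>
           (\<forall>u w. l2_inner J (A u) (B w) = 0) \<and>
           (\<forall>u. (l2_norm J (A u))\<^sup>2 + (l2_norm J (B u))\<^sup>2 = (norm u)\<^sup>2)"
proof -
  have A_l2: "A u \<in> l2 J" and B_l2: "B u \<in> l2 J" for u
    unfolding A_def B_def by (intro diag_op_in_l2 a b analysis_op_in_l2 frame)+
  have analysis: "analysis_op J (\<lambda>j. a j *\<^sub>R P (x j) + b j *\<^sub>R (x j - P (x j))) u
      = (\<lambda>j. A u j + B u j)" for u
    unfolding A_def B_def by (rule analysis_op_piecewise[OF P])
  have parseval: "parseval_frame J (\<lambda>j. a j *\<^sub>R P (x j) + b j *\<^sub>R (x j - P (x j))) \<longleftrightarrow>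
      (\<forall>u. (l2_norm J (A u))\<^sup>2 + (l2_norm J (B u))\<^sup>2 + 2 * l2_inner J (A u) (B u) = (norm u)\<^sup>2)"
    using l2_add[OF A_l2 B_l2]
    by (subst parseval_frame_iff_isometry)
       (simp_all add: analysis l2_norm_add_power2[OF A_l2 B_l2])
  have "l2_inner J (A u) (B w) = 0"
    if iso: "\<And>u. (l2_norm J (A u))\<^sup>2 + (l2_norm J (B u))\<^sup>2 + 2 * l2_inner J (A u) (B u) = (norm u)\<^sup>2"
    for u w
  proof -
    interpret P: bounded_linear P
      using P by (simp add: orthogonal_projection_def)
    have PP: "P (P v) = P v" for v
      using P by (simp add: orthogonal_projection_def)
    have A_split: "A (P u + (v - P v)) = A u" and B_split: "B (P u + (v - P v)) = B v" for v
      by (simp_all add: A_def B_def P.add P.diff PP)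
    have energy: "(l2_norm J (A u))\<^sup>2 + (l2_norm J (B v))\<^sup>2 + 2 * l2_inner J (A u) (B v)
        = (norm (P u))\<^sup>2 + (norm (v - P v))\<^sup>2" for v
      using iso[of "P u + (v - P v)"]
      by (simp only: A_split B_split norm_power2_projection_split[OF P])
    have B_minus: "B (- w) = (\<lambda>j. - B w j)"
      by (auto simp: B_def diag_op_def analysis_op_def P.neg inner_diff algebra_simps)
    have "l2_inner J (A u) (B (- w)) = - l2_inner J (A u) (B w)"
         "(l2_norm J (B (- w)))\<^sup>2 = (l2_norm J (B w))\<^sup>2"
      by (simp_all add: B_minus l2_norm_power2 l2_inner_def infsum_uminus)
    moreover have "norm (- w - P (- w)) = norm (w - P w)"
      by (simp add: P.neg norm_minus_commute)
    ultimately show ?thesis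
      using energy[of w] energy[of "- w"] by simp
  qed
  then show ?thesis
    unfolding parseval by auto
qed

theorem corollary3p3:
  fixes J :: "nat set"
    and x :: "nat \<Rightarrow> 'a::{real_inner, polish_space}"
    and P :: "'a \<Rightarrow> 'a"
  assumes "J \<noteq> {}"
    and "frame J x"
    and "\<And>j. j \<in> J \<Longrightarrow> norm (x j) = 1"
    and "orthogonal_projection P"
  shows
    "(scalable J x \<longleftrightarrow>
       (\<exists>c\<in>l_infty J. \<forall>u f.
          - (1/2) * (norm f)\<^sup>2
            \<le> (1/2) * (l2_norm J (diag_op c (analysis_op J x u)))\<^sup>2 - f \<bullet> u \<and>
          (1/2) * (l2_norm J (diag_op c (analysis_op J x u)))\<^sup>2 - f \<bullet> u
            \<le> (1/2) * (norm u)\<^sup>2 - f \<bullet> u))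
     \<and>
     (piecewise_scalable J x P \<longleftrightarrow>
       (\<exists>a\<in>l_infty J. \<exists>b\<in>l_infty J.
          (\<forall>u w. l2_inner J (diag_op a (analysis_op J x (P u)))
                            (diag_op b (analysis_op J x (w - P w))) = 0) \<and>
          (\<forall>u f.
             - (1/2) * (norm f)\<^sup>2
               \<le> (1/2) * ((l2_norm J (diag_op a (analysis_op J x (P u))))\<^sup>2
                          + (l2_norm J (diag_op b (analysis_op J x (u - P u))))\<^sup>2) - f \<bullet> u \<and>
             (1/2) * ((l2_norm J (diag_op a (analysis_op J x (P u))))\<^sup>2
                      + (l2_norm J (diag_op b (analysis_op J x (u - P u))))\<^sup>2) - f \<bullet> u
               \<le> (1/2) * (norm u)\<^sup>2 - f \<bullet> u)))"
proof
  have "parseval_frame J (\<lambda>j. c j *\<^sub>R x j) \<longleftrightarrow>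
      (\<forall>u. (l2_norm J (diag_op c (analysis_op J x u)))\<^sup>2 = (norm u)\<^sup>2)" if "c \<in> l_infty J" for c
    using diag_op_in_l2[OF that analysis_op_in_l2[OF assms(2)]]
    by (subst parseval_frame_iff_isometry) (simp_all add: analysis_op_scaleR)
  then show "scalable J x \<longleftrightarrow>
       (\<exists>c\<in>l_infty J. \<forall>u f.
          - (1/2) * (norm f)\<^sup>2
            \<le> (1/2) * (l2_norm J (diag_op c (analysis_op J x u)))\<^sup>2 - f \<bullet> u \<and>
          (1/2) * (l2_norm J (diag_op c (analysis_op J x u)))\<^sup>2 - f \<bullet> u
            \<le> (1/2) * (norm u)\<^sup>2 - f \<bullet> u)"
    unfolding scalable_def variational_bounds_iff by (intro bex_cong) auto
next
  show "piecewise_scalable J x P \<longleftrightarrow>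
       (\<exists>a\<in>l_infty J. \<exists>b\<in>l_infty J.
          (\<forall>u w. l2_inner J (diag_op a (analysis_op J x (P u)))
                            (diag_op b (analysis_op J x (w - P w))) = 0) \<and>
          (\<forall>u f.
             - (1/2) * (norm f)\<^sup>2
               \<le> (1/2) * ((l2_norm J (diag_op a (analysis_op J x (P u))))\<^sup>2
                          + (l2_norm J (diag_op b (analysis_op J x (u - P u))))\<^sup>2) - f \<bullet> u \<and>
             (1/2) * ((l2_norm J (diag_op a (analysis_op J x (P u))))\<^sup>2
                      + (l2_norm J (diag_op b (analysis_op J x (u - P u))))\<^sup>2) - f \<bullet> u
               \<le> (1/2) * (norm u)\<^sup>2 - f \<bullet> u))"
    unfolding piecewise_scalable_def variational_bounds_iff
    by (intro bex_cong refl) (rule parseval_splitting_iff[OF assms(2,4)])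
qed

end
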